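(* Let $(P_q)$ be a sequence of $L^2$-normalized Littlewood polynomials. Suppose that each $P_q$ is palindromic of even degree. Then for every real $\alpha\ge 0$ the sequence $(P_q)$ is not $L^\alpha$-flat.
   Context: $S^1$ is the unit circle and $dz$ the normalized Lebesgue measure on it; all $L^\alpha$ norms are with respect to $dz$. A sequence $(P_q)$ of $L^2$-normalized Littlewood polynomials is indexed by $q$ running through an infinite set of positive integers, with $$P_q(z)=\frac1{\sqrt q}\sum_{j=0}^{q-1}\epsilon^{(q)}_j z^j,\qquad \epsilon^{(q)}_j\in\{+1,-1\},\ z\in S^1,$$ so that $P_q$ has degree $q-1$. A polynomial $f(z)=\sum_{j=0}^n a_jz^j$ of degree $n$ is palindromic if $a_k=a_{n-k}$ for all $0\le k\le n$. Flatness: for real $\alpha>0$, a sequence $(P_n)$ of analytic trigonometric polynomials of $L^2(S^1,dz)$ norm $1$ is $L^\alpha$-flat if $|P_n|$ converges to the constant function $1$ in $L^\alpha$, i.e. $\int_{S^1}\big||P_n|-1\big|^\alpha dz\to 0$. For $\alpha=0$, $(P_n)$ is $L^0$-flat if the Mahler measures $M(P_n)=\exp\left(\int_{S^1}\log|P_n(z)|\,dz\right)$ converge to $1$. *)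

theory Defs
  imports "HOL-Analysis.Analysis" "HOL-Computational_Algebra.Polynomial"
begin

definition circle_measure :: "complex measure" where
  "circle_measure =
     distr (uniform_measure lborel {0..<2 * pi}) (restrict_space borel (sphere 0 1)) cis"

definition normalized_littlewood :: "nat \<Rightarrow> complex poly \<Rightarrow> bool" where
  "normalized_littlewood q p \<longleftrightarrow>
     (\<exists>\<epsilon> :: nat \<Rightarrow> real. (\<forall>j<q. \<epsilon> j \<in> {1, -1}) \<and>
        p = smult (complex_of_real (1 / sqrt (real q))) (\<Sum>j<q. monom (complex_of_real (\<epsilon> j)) j))"

definition palindromic :: "complex poly \<Rightarrow> bool" where
  "palindromic p \<longleftrightarrow> (\<forall>k\<le>degree p. coeff p k = coeff p (degree p - k))"

text \<open>The real logarithm of HOL has \<open>ln 0 = 0\<close>. For nonzero \<open>p\<close> this only concerns the finitely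
  many zeros of \<open>p\<close> on the circle, a null set; the zero polynomial is treated separately,
  following the convention \<open>exp (-\<infinity>) = 0\<close>.\<close>

definition mahler_measure :: "complex poly \<Rightarrow> real" where
  "mahler_measure p =
     (if p = 0 then 0 else exp (\<integral>z. ln (cmod (poly p z)) \<partial>circle_measure))"

text \<open>Flatness of a family of polynomials indexed by \<open>q \<in> Q\<close>, as \<open>q \<rightarrow> \<infinity>\<close> within \<open>Q\<close>; the
  values of \<open>P\<close> outside \<open>Q\<close> are irrelevant. Only \<open>\<alpha> \<ge> 0\<close> and polynomials of
  \<open>L\<^sup>2\<close>-norm \<open>1\<close> are meant.\<close>

definition flat :: "real \<Rightarrow> nat set \<Rightarrow> (nat \<Rightarrow> complex poly) \<Rightarrow> bool" where
  "flat \<alpha> Q P \<longleftrightarrow>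
     (if \<alpha> = 0
      then ((\<lambda>q. mahler_measure (P q)) \<longlongrightarrow> 1) (inf sequentially (principal Q))
      else ((\<lambda>q. \<integral>z. \<bar>cmod (poly (P q) z) - 1\<bar> powr \<alpha> \<partial>circle_measure) \<longlongrightarrow> 0)
             (inf sequentially (principal Q)))"

end

theory Submission
  imports Defs "HOL-Probability.Probability_Measure"
begin

text \<open>
  If \<open>p\<close> is palindromic of degree \<open>2 * m\<close> with real coefficients of equal modulus, then \<open>R z = z\<^sup>-\<^sup>m p z\<close> is
  real on the circle and \<open>\<bar>R\<bar> = \<bar>p\<bar>\<close>. If \<open>\<bar>R\<bar>\<close> is close to \<open>1\<close>, then \<open>R\<close> is close to a function \<open>u\<close>
  with values \<open>1\<close> and \<open>-1\<close>, and for such a function the squared \<open>L\<^sup>2\<close>-distance \<open>d h\<close> between \<open>u\<close> and its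
  rotation by the angle \<open>h\<close> is subadditive; in particular \<open>d (2 * h) \<le> 2 * d h\<close>. By Parseval, however,
  this distance for \<open>R\<close> is the average of \<open>2 - 2 * cos (k * h)\<close> over \<open>\<bar>k\<bar> \<le> m\<close>, which grows
  quadratically in \<open>h\<close> for \<open>h\<close> up to \<open>1 / m\<close>. This contradiction at \<open>h = 1 / m\<close> bounds the
  \<open>L\<^sup>1\<close>-norm of \<open>p\<close> away from \<open>1\<close> by an absolute constant. Flatness of any order \<open>\<alpha> \<ge> 0\<close> forces the
  \<open>L\<^sup>1\<close>-norms to tend to \<open>1\<close>.
\<close>

section \<open>Rotations of the circle\<close>

lemma space_circle_measure [simp]: "space circle_measure = sphere 0 1"
  by (simp add: circle_measure_def space_restrict_space)

lemma sets_circle_measure [measurable_cong]: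
  "sets circle_measure = sets (restrict_space borel (sphere 0 1))"
  by (simp add: circle_measure_def)

lemma measurable_cis [measurable]: "cis \<in> borel \<rightarrow>\<^sub>M restrict_space borel (sphere 0 1)"
  by (intro measurable_restrict_space2 borel_measurable_continuous_onI continuous_intros) auto

lemma borel_measurable_circle_continuous:
  fixes f :: "complex \<Rightarrow> 'a::topological_space"
  assumes "continuous_on (sphere 0 1) f"
  shows "f \<in> borel_measurable circle_measure"
  using borel_measurable_continuous_on_restrict[OF assms]
  by (simp add: measurable_cong_sets[OF sets_circle_measure])

lemma prob_space_circle_measure: "prob_space circle_measure"
proof -
  interpret prob_space "uniform_measure lborel {0..<2 * pi}"
    by (rule prob_space_uniform_measure) auto
  show ?thesis
    unfolding circle_measure_def by (rule prob_space_distr) measurable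
qed

interpretation circle: prob_space circle_measure
  by (rule prob_space_circle_measure)

lemma integrable_circle_continuous:
  fixes f :: "complex \<Rightarrow> 'a::{banach, second_countable_topology}"
  assumes "continuous_on (sphere 0 1) f"
  shows "integrable circle_measure f"
proof -
  have "compact (f ` sphere 0 1)"
    using assms by (intro compact_continuous_image) auto
  then obtain B where "\<forall>y\<in>f ` sphere 0 1. norm y \<le> B"
    using compact_imp_bounded bounded_iff by metis
  then show ?thesis
    by (intro circle.integrable_const_bound[where B = B] AE_I2
        borel_measurable_circle_continuous assms) auto
qed

section \<open>Invariance of the normalized measure under rotations\<close>

lemma emeasure_circle:
  assumes "A \<in> sets circle_measure"
  shows "emeasure circle_measure A =
    emeasure lborel ({0..<2 * pi} \<inter> cis -` A) / ennreal (2 * pi)"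
proof -
  have m: "cis -` A \<in> sets lborel"
    using measurable_sets[OF measurable_cis, of A] assms by (simp add: sets_circle_measure)
  have "emeasure circle_measure A = emeasure (uniform_measure lborel {0..<2 * pi}) (cis -` A)"
    using assms unfolding circle_measure_def by (subst emeasure_distr) auto
  also have "\<dots> = emeasure lborel ({0..<2 * pi} \<inter> cis -` A) / emeasure lborel {0..<2*pi}"
    by (rule emeasure_uniform_measure) (use m in auto)
  finally show ?thesis by simp
qed

lemma emeasure_lborel_shift:
  fixes B :: "real set"
  assumes "B \<in> sets borel"
  shows "emeasure lborel ((+) c -` B) = emeasure lborel B"
proof -
  have "emeasure lborel B = emeasure (distr lborel borel ((+) c)) B"
    by (simp add: lborel_distr_plus)
  also have "\<dots> = emeasure lborel ((+) c -` B)"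
    using assms by (subst emeasure_distr) auto
  finally show ?thesis ..
qed

text \<open>The window \<open>{s..<s+p}\<close> is cut at \<open>p\<close>; periodicity moves the
  part beyond \<open>p\<close> back to \<open>{0..<s}\<close>, which completes
  \<open>{s..<p}\<close> to one full period.\<close>

lemma emeasure_lborel_periodic_shift:
  fixes B :: "real set"
  assumes B [measurable]: "B \<in> sets borel" and per: "\<And>t. p + t \<in> B \<longleftrightarrow> t \<in> B"
    and s: "0 \<le> s" "s \<le> p"
  shows "emeasure lborel ({0..<p} \<inter> (+) s -` B) = emeasure lborel ({0..<p} \<inter> B)"
proof -
  have "emeasure lborel ({0..<p} \<inter> (+) s -` B) = emeasure lborel ((+) s -` ({s..<s+p} \<inter> B))"
    by (intro arg_cong2[where f = emeasure]) auto
  also have "\<dots> = emeasure lborel ({s..<s+p} \<inter> B)"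
    by (intro emeasure_lborel_shift) auto
  also have "{s..<s+p} \<inter> B = ({s..<p} \<inter> B) \<union> ({p..<s+p} \<inter> B)"
    using s by auto
  also have "emeasure lborel \<dots> = emeasure lborel ({s..<p} \<inter> B) + emeasure lborel ({p..<s+p} \<inter> B)"
    by (intro plus_emeasure[symmetric]) auto
  also have "emeasure lborel ({p..<s+p} \<inter> B) = emeasure lborel ((+) p -` ({p..<s+p} \<inter> B))"
    by (intro emeasure_lborel_shift[symmetric]) auto
  also have "(+) p -` ({p..<s+p} \<inter> B) = {0..<s} \<inter> B"
    by (auto simp: per)
  also have "emeasure lborel ({s..<p} \<inter> B) + emeasure lborel ({0..<s} \<inter> B)
      = emeasure lborel (({s..<p} \<inter> B) \<union> ({0..<s} \<inter> B))"
    by (intro plus_emeasure) auto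
  also have "({s..<p} \<inter> B) \<union> ({0..<s} \<inter> B) = {0..<p} \<inter> B"
    using s by auto
  finally show ?thesis .
qed

lemma measurable_circle_rotation:
  assumes "norm w = 1"
  shows "(*) w \<in> circle_measure \<rightarrow>\<^sub>M circle_measure"
proof -
  have "(*) w \<in> circle_measure \<rightarrow>\<^sub>M restrict_space borel (sphere 0 1)"
    using assms by (intro measurable_restrict_space2 borel_measurable_circle_continuous continuous_intros)
      (auto simp: norm_mult)
  then show ?thesis
    by (simp add: measurable_cong_sets[OF refl sets_circle_measure])
qed

text \<open>In terms of the angle, multiplication by \<open>w\<close> is the shift by
  \<open>Arg2pi w\<close>, and preimages under \<open>cis\<close> have period
  \<open>2 * pi\<close>.\<close>

lemma distr_circle_rotation:
  assumes "norm w = 1"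
  shows "distr circle_measure circle_measure ((*) w) = circle_measure"
proof (rule measure_eqI)
  define s where "s = Arg2pi w"
  have s: "0 \<le> s" "s < 2 * pi" "w = cis s"
    using assms complex_norm_eq_1_exp[of w]
    by (simp_all add: s_def Arg2pi_ge_0 Arg2pi_lt_2pi cis_conv_exp)
  fix A assume "A \<in> sets (distr circle_measure circle_measure ((*) w))"
  then have A: "A \<in> sets circle_measure" by simp
  have cA: "cis -` A \<in> sets borel"
    using measurable_sets[OF measurable_cis, of A] A by (simp add: sets_circle_measure)
  have rot: "(*) w -` A \<inter> sphere 0 1 \<in> sets circle_measure"
    using measurable_sets[OF measurable_circle_rotation[OF assms] A] by simp
  have "emeasure (distr circle_measure circle_measure ((*) w)) A
      = emeasure circle_measure ((*) w -` A \<inter> sphere 0 1)"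
    using A measurable_circle_rotation[OF assms] by (subst emeasure_distr) auto
  also have "\<dots> = emeasure lborel ({0..<2 * pi} \<inter> (+) s -` (cis -` A)) / ennreal (2 * pi)"
    unfolding emeasure_circle[OF rot]
    by (intro arg_cong[where f = "\<lambda>S. emeasure lborel S / _"]) (auto simp: s cis_mult)
  also have "emeasure lborel ({0..<2 * pi} \<inter> (+) s -` (cis -` A))
      = emeasure lborel ({0..<2 * pi} \<inter> cis -` A)"
  proof (rule emeasure_lborel_periodic_shift)
    have "cis (2 * pi + t) = cis t" for t by (simp flip: cis_mult)
    then show "2 * pi + t \<in> cis -` A \<longleftrightarrow> t \<in> cis -` A" for t by simp
  qed (use s cA in auto)
  also have "\<dots> / ennreal (2 * pi) = emeasure circle_measure A"
    by (simp add: emeasure_circle[OF A])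
  finally show "emeasure (distr circle_measure circle_measure ((*) w)) A = emeasure circle_measure A" .
qed simp

lemma integral_circle_rotation:
  fixes f :: "complex \<Rightarrow> 'a::{banach, second_countable_topology}"
  assumes "norm w = 1" and "f \<in> borel_measurable circle_measure"
  shows "(\<integral>z. f (w * z) \<partial>circle_measure) = (\<integral>z. f z \<partial>circle_measure)"
  using integral_distr[OF measurable_circle_rotation assms(2), of w] assms(1)
  by (simp add: distr_circle_rotation)

lemma integrable_circle_rotation:
  fixes f :: "complex \<Rightarrow> 'a::{banach, second_countable_topology}"
  assumes "norm w = 1" and "integrable circle_measure f"
  shows "integrable circle_measure (\<lambda>z. f (w * z))"
  using integrable_distr[OF measurable_circle_rotation, of w f] assms
  by (simp add: distr_circle_rotation)

lemma integral_circle_monomials: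
  "(\<integral>z. z ^ j * cnj z ^ k \<partial>circle_measure) = (if j = k then 1 else 0)"
proof (cases "j = k")
  case True
  have "(\<integral>z. z ^ j * cnj z ^ k \<partial>circle_measure) = (\<integral>z. 1 \<partial>circle_measure)"
    by (rule Bochner_Integration.integral_cong)
       (auto simp: True simp flip: power_mult_distrib complex_norm_square)
  then show ?thesis using True by (simp add: circle.prob_space del: space_circle_measure)
next
  case False
  \<comment> \<open>The angle is chosen so that \<open>w ^ j * cnj w ^ k\<close> is
    \<open>cis pi\<close>, that is \<open>- 1\<close>; invariance under this rotation then gives
    \<open>?I = - ?I\<close>.\<close>
  define w where "w = cis (pi / (real j - real k))"
  let ?I = "\<integral>z. z ^ j * cnj z ^ k \<partial>circle_measure"
  have w: "norm w = 1" by (simp add: w_def)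
  have "?I = (\<integral>z. (w * z) ^ j * cnj (w * z) ^ k \<partial>circle_measure)"
    by (rule integral_circle_rotation[symmetric, OF w])
       (intro borel_measurable_circle_continuous continuous_intros)
  also have "\<dots> = (\<integral>z. (w ^ j * cnj w ^ k) * (z ^ j * cnj z ^ k) \<partial>circle_measure)"
    by (simp add: power_mult_distrib mult_ac)
  also have "\<dots> = w ^ j * cnj w ^ k * ?I" by simp
  finally have "(1 - w ^ j * cnj w ^ k) * ?I = 0" by (simp add: algebra_simps)
  moreover have "w ^ j * cnj w ^ k = - 1"
  proof -
    have "w ^ j * cnj w ^ k = cis ((real j - real k) * (pi / (real j - real k)))"
      by (simp add: w_def Complex.DeMoivre cis_cnj cis_mult diff_divide_distrib algebra_simps)
    then show ?thesis using False by simp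
  qed
  ultimately show ?thesis using False by auto
qed

section \<open>A gap for the mean modulus of palindromic polynomials\<close>

lemma integral_circle_parseval:
  fixes a b :: "nat \<Rightarrow> complex"
  shows "(\<integral>z. (\<Sum>j<n. a j * z ^ j) * cnj (\<Sum>j<n. b j * z ^ j) \<partial>circle_measure) =
    (\<Sum>j<n. a j * cnj (b j))"
proof -
  have int: "integrable circle_measure (\<lambda>z. a j * cnj (b k) * (z ^ j * cnj z ^ k))" for j k
    by (intro integrable_circle_continuous continuous_intros)
  have "(\<integral>z. (\<Sum>j<n. a j * z ^ j) * cnj (\<Sum>j<n. b j * z ^ j) \<partial>circle_measure) =
      (\<integral>z. (\<Sum>j<n. \<Sum>k<n. a j * cnj (b k) * (z ^ j * cnj z ^ k)) \<partial>circle_measure)"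
    by (simp add: sum_product mult_ac)
  also have "\<dots> = (\<Sum>j<n. \<Sum>k<n. a j * cnj (b k) * (\<integral>z. z ^ j * cnj z ^ k \<partial>circle_measure))"
    by (subst Bochner_Integration.integral_sum; (intro Bochner_Integration.integrable_sum int)?;
        subst Bochner_Integration.integral_sum; (intro int)?) simp
  also have "\<dots> = (\<Sum>j<n. a j * cnj (b j))"
    by (intro sum.cong) (simp_all add: integral_circle_monomials if_distrib[of "(*) _"] cong: if_cong)
  finally show ?thesis .
qed

section \<open>Trigonometric estimates for the Parseval sum\<close>

lemma sin_ge_half:
  fixes x :: real
  assumes "0 \<le> x" "x \<le> 1"
  shows "x / 2 \<le> sin x"
proof (cases "x = 0")
  case False
  with assms have "0 < x" by simp
  then obtain y where y: "0 < y" "y < x" "sin x - sin 0 = (x - 0) * cos y"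
    using MVT2[of 0 x sin cos] by (auto intro: DERIV_sin)
  \<comment> \<open>The half-angle formula turns this bound into \<open>cos y \<ge> 1 / 2\<close>,
    the slope needed in the mean value theorem.\<close>
  have "\<bar>sin (y / 2)\<bar> \<le> 1 / 2"
    using abs_sin_x_le_abs_x[of "y / 2"] y assms by linarith
  then have "(sin (y / 2))\<^sup>2 \<le> (1 / 2)\<^sup>2"
    by (subst power2_abs[symmetric]) (rule power_mono, auto)
  then have "1 / 2 \<le> cos y"
    using cos_double_sin[of "y / 2"] by (simp add: power2_eq_square)
  then show ?thesis
    using mult_left_mono[of "1 / 2" "cos y" x] y(3) \<open>0 < x\<close> by simp
qed simp

text \<open>The left side is the contribution of one frequency to the integral of \<open>F\<close>
  in \<open>palindromic_L1_norm_gap\<close>. With \<open>s\<close> the square of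
  \<open>sin (x / 2)\<close> it equals \<open>- 4 * s * (1 - 2 * s)\<close>, where
  \<open>1 - 2 * s \<ge> 1 / 2\<close> and \<open>s \<ge> x\<^sup>2 / 16\<close>.\<close>

lemma cos_second_difference_le:
  fixes x :: real
  assumes "\<bar>x\<bar> \<le> 1"
  shows "1 - 2 * cos x + cos (2 * x) \<le> - (x\<^sup>2 / 8)"
proof -
  define s where "s = (sin (x / 2))\<^sup>2"
  have c: "cos x = 1 - 2 * s"
    using cos_double_sin[of "x / 2"] by (simp add: s_def)
  have "\<bar>sin (x / 2)\<bar> \<le> 1 / 2"
    using abs_sin_x_le_abs_x[of "x / 2"] assms by simp
  then have s1: "s \<le> (1 / 2)\<^sup>2"
    unfolding s_def by (subst power2_abs[symmetric]) (rule power_mono, auto)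
  have "\<bar>x\<bar> / 2 / 2 \<le> sin (\<bar>x\<bar> / 2)"
    using assms by (intro sin_ge_half) auto
  then have "(\<bar>x\<bar> / 2 / 2)\<^sup>2 \<le> (sin (\<bar>x\<bar> / 2))\<^sup>2"
    by (intro power_mono) auto
  also have "\<dots> = s"
    unfolding s_def by (cases "x \<ge> 0") auto
  finally have s2: "x\<^sup>2 / 16 \<le> s" by (simp add: power_divide)
  have "1 - 2 * cos x + cos (2 * x) = - 4 * s * (1 - 2 * s)"
    unfolding cos_double_cos c by (simp add: power2_eq_square algebra_simps)
  moreover have "s * (1 / 2) \<le> s * (1 - 2 * s)"
    using s1 by (intro mult_left_mono) (auto simp: s_def power2_eq_square)
  ultimately show ?thesis using s2 by simp
qed

lemma sum_square_diff:
  fixes c :: real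
  shows "(\<Sum>j<n. (real j - c)\<^sup>2) =
    real n * (real n - 1) * (2 * real n - 1) / 6 - c * real n * (real n - 1) + c\<^sup>2 * real n"
  by (induction n) (simp_all add: field_simps power2_eq_square)

text \<open>All arguments \<open>(real j - real m) / real m\<close> lie in \<open>{-1..1}\<close>,
  so the quadratic bound applies to each term. Summing the squares leaves a factor
  \<open>(m + 1) / m \<ge> 1\<close>, which makes the constant uniform in \<open>m\<close>.\<close>

lemma sum_cos_second_difference_le:
  assumes "0 < m"
  shows "(\<Sum>j<2 * m + 1. 1 - 2 * cos ((real j - real m) / real m) + cos (2 * ((real j - real m) / real m)))
    \<le> - (real (2 * m + 1) / 24)"
proof -
  have "(\<Sum>j<2 * m + 1. 1 - 2 * cos ((real j - real m) / real m) + cos (2 * ((real j - real m) / real m)))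
      \<le> (\<Sum>j<2 * m + 1. - (((real j - real m) / real m)\<^sup>2 / 8))"
    using assms by (intro sum_mono cos_second_difference_le) (auto simp: field_simps abs_le_iff)
  also have "\<dots> = - ((\<Sum>j<2 * m + 1. (real j - real m)\<^sup>2) / (8 * (real m)\<^sup>2))"
    unfolding sum_divide_distrib sum_negf by (simp add: power_divide mult.commute del: sum.lessThan_Suc)
  also have "(\<Sum>j<2 * m + 1. (real j - real m)\<^sup>2) = real (2 * m + 1) * (real m * (real m + 1)) / 3"
    unfolding sum_square_diff by (simp add: field_simps power2_eq_square)
  also have "- (real (2 * m + 1) * (real m * (real m + 1)) / 3 / (8 * (real m)\<^sup>2))
      = - (real (2 * m + 1) / 24) - real (2 * m + 1) / (24 * real m)"
    using assms by (simp add: divide_simps power2_eq_square) (simp add: algebra_simps)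
  also have "\<dots> \<le> - (real (2 * m + 1) / 24)"
    by simp
  finally show ?thesis .
qed

text \<open>For signs \<open>a\<close>, \<open>b\<close>, \<open>c\<close> one has \<open>(b - a) * (b - c) \<ge> 0\<close>, which is the subadditivity
  \<open>(c - a)\<^sup>2 \<le> (b - a)\<^sup>2 + (c - b)\<^sup>2\<close>; here it is perturbed. The constant \<open>1 / 48\<close> is half of the gap \<open>1 / 24\<close>
  in \<open>sum_cos_second_difference_le\<close>.\<close>

lemma near_sign_product_ge:
  fixes a b c :: real and e :: "real \<Rightarrow> real"
  defines "e \<equiv> \<lambda>x. \<bar>\<bar>x\<bar> - 1\<bar>"
  shows "- 1 / 48 - 400 * ((e a)\<^sup>2 + (e b)\<^sup>2 + (e c)\<^sup>2) \<le> (b - a) * (b - c)"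
proof -
  have split: "\<exists>u d. x = u + d \<and> (u = 1 \<or> u = - 1) \<and> \<bar>d\<bar> = e x" for x
  proof (cases "x \<ge> 0")
    case True
    then show ?thesis by (intro exI[of _ 1] exI[of _ "x - 1"]) (auto simp: e_def)
  next
    case False
    then show ?thesis by (intro exI[of _ "- 1"] exI[of _ "x + 1"]) (auto simp: e_def abs_if)
  qed
  obtain ua da where a: "a = ua + da" "ua = 1 \<or> ua = - 1" "\<bar>da\<bar> = e a" using split by blast
  obtain ub db where b: "b = ub + db" "ub = 1 \<or> ub = - 1" "\<bar>db\<bar> = e b" using split by blast
  obtain uc dc where c: "c = uc + dc" "uc = 1 \<or> uc = - 1" "\<bar>dc\<bar> = e c" using split by blast
  have sgn: "0 \<le> (ub - ua) * (ub - uc)" and ba: "\<bar>ub - ua\<bar> \<le> 2" and bc: "\<bar>ub - uc\<bar> \<le> 2"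
    using a(2) b(2) c(2) by auto
  have 1: "\<bar>(ub - ua) * (db - dc)\<bar> \<le> 2 * (e b + e c)"
    unfolding abs_mult using ba b(3) c(3) by (intro mult_mono) auto
  have 2: "\<bar>(db - da) * (ub - uc)\<bar> \<le> (e b + e a) * 2"
    unfolding abs_mult using bc b(3) a(3) by (intro mult_mono) auto
  have "\<bar>(db - da) * (db - dc)\<bar> \<le> (e b + e a) * (e b + e c)"
    unfolding abs_mult using a(3) b(3) c(3) by (intro mult_mono) auto
  also have "\<dots> \<le> (e a)\<^sup>2 + 2 * (e b)\<^sup>2 + (e c)\<^sup>2"
    using sum_squares_bound[of "e a" "e b"] sum_squares_bound[of "e a" "e c"]
      sum_squares_bound[of "e b" "e c"] by (simp add: power2_eq_square algebra_simps)
  finally have 3: "\<bar>(db - da) * (db - dc)\<bar> \<le> (e a)\<^sup>2 + 2 * (e b)\<^sup>2 + (e c)\<^sup>2" .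
  have "(b - a) * (b - c) = (ub - ua) * (ub - uc) + (ub - ua) * (db - dc)
      + (db - da) * (ub - uc) + (db - da) * (db - dc)"
    unfolding a(1) b(1) c(1) by (simp add: algebra_simps)
  with sgn 1 2 3 have
    "- (2 * e a + 4 * e b + 2 * e c + (e a)\<^sup>2 + 2 * (e b)\<^sup>2 + (e c)\<^sup>2) \<le> (b - a) * (b - c)"
    unfolding abs_le_iff by simp
  \<comment> \<open>The weight is chosen so that the linear terms, with coefficients 2, 4 and 2,
    cost \<open>8 / 384 = 1 / 48\<close> in total; the squares then get coefficients at most 386,
    below 400.\<close>
  moreover have "e x \<le> 1 / 384 + 96 * (e x)\<^sup>2" for x
    using zero_le_power2[of "e x - 1 / 192"] unfolding power2_diff by (simp add: power_divide)
  from this[of a] this[of b] this[of c]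
  have "2 * e a + 4 * e b + 2 * e c + (e a)\<^sup>2 + 2 * (e b)\<^sup>2 + (e c)\<^sup>2
      \<le> 1 / 48 + 193 * (e a)\<^sup>2 + 386 * (e b)\<^sup>2 + 193 * (e c)\<^sup>2"
    by simp
  moreover have "0 \<le> (e a)\<^sup>2" "0 \<le> (e b)\<^sup>2" "0 \<le> (e c)\<^sup>2" by auto
  ultimately show ?thesis by argo
qed

text \<open>Two bounds for the integral of \<open>F\<close> are compared: Parseval puts it below
  \<open>- 1 / 24\<close>, while values close to signs would keep it near or above
  \<open>- 1 / 48\<close>. So the mean of the squared deviation \<open>E\<close> is bounded below;
  as the L2 norm is 1, this mean is 2 minus twice the L1 norm.\<close>

lemma palindromic_L1_norm_gap:
  fixes a :: "nat \<Rightarrow> real"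
  assumes m: "0 < m"
    and sq: "\<And>j. j \<le> 2 * m \<Longrightarrow> (a j)\<^sup>2 = 1 / real (2 * m + 1)"
    and pal: "\<And>j. j \<le> 2 * m \<Longrightarrow> a (2 * m - j) = a j"
  defines "p \<equiv> \<lambda>z. \<Sum>j<2 * m + 1. of_real (a j) * z ^ j"
  shows "(\<integral>z. cmod (p z) \<partial>circle_measure) \<le> 1 - 1 / 120000"
proof -
  define n where "n = 2 * m + 1"
  have "n \<noteq> 0" by (simp add: n_def)
  define R where "R = (\<lambda>z. Re (cnj z ^ m * p z))"
  have cont_p: "continuous_on (sphere 0 1) p"
    unfolding p_def by (intro continuous_intros)
  have cont: "continuous_on (sphere 0 1) R"
    unfolding R_def by (intro continuous_intros cont_p)
  have R: "of_real (R z) = cnj z ^ m * p z" if "norm z = 1" for z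
  proof -
    have zz: "z * cnj z = 1"
      using that by (simp flip: complex_norm_square)
    \<comment> \<open>Reversing the sum and using the symmetry of the real coefficients gives
      \<open>p z = z ^ (2 * m) * cnj (p z)\<close>, so \<open>cnj z ^ m * p z\<close> is its own
      conjugate.\<close>
    have "p z = (\<Sum>j<n. of_real (a (n - Suc j)) * z ^ (n - Suc j))"
      unfolding p_def n_def by (rule sum.nat_diff_reindex[symmetric])
    also have "\<dots> = (\<Sum>j<n. z ^ (2 * m) * (of_real (a j) * cnj z ^ j))"
    proof (intro sum.cong refl)
      fix j assume "j \<in> {..<n}"
      then have j: "j \<le> 2 * m" by (simp add: n_def)
      have "z ^ (2 * m) * cnj z ^ j = z ^ (2 * m - j) * (z * cnj z) ^ j"
        using j by (simp add: power_mult_distrib flip: power_add)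
      then show "of_real (a (n - Suc j)) * z ^ (n - Suc j) = z ^ (2 * m) * (of_real (a j) * cnj z ^ j)"
        using pal[OF j] by (simp add: n_def zz)
    qed
    also have "\<dots> = z ^ (2 * m) * cnj (p z)"
      by (simp add: p_def n_def sum_distrib_left del: sum.lessThan_Suc)
    finally have "cnj z ^ m * p z = cnj z ^ m * (z ^ (2 * m) * cnj (p z))"
      by (rule arg_cong)
    also have "\<dots> = (z * cnj z) ^ m * (z ^ m * cnj (p z))"
      unfolding power_mult_distrib mult_2 power_add by (simp only: mult_ac)
    also have "\<dots> = cnj (cnj z ^ m * p z)"
      by (simp add: zz)
    finally have "cnj z ^ m * p z = cnj (cnj z ^ m * p z)" .
    then show ?thesis
      unfolding R_def by (metis Reals_cnj_iff of_real_Re)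
  qed
  have absR: "\<bar>R z\<bar> = cmod (p z)" if "norm z = 1" for z
    using arg_cong[OF R[OF that], of norm] that by (simp add: norm_mult norm_power)
  \<comment> \<open>\<open>1 / m\<close> is the largest angle for which all phases
    \<open>(j - m) / m\<close> stay in \<open>{-1..1}\<close>.\<close>
  define w where "w = cis (1 / real m)"
  have w: "norm w = 1" by (simp add: w_def)
  have ww: "norm (w * w) = 1" by (simp add: w_def norm_mult)
  \<comment> \<open>In \<open>R\<close> the coefficient \<open>a j\<close> belongs to frequency
    \<open>j - m\<close>, so rotation by \<open>w\<close> multiplies that term by
    \<open>u j\<close>.\<close>
  define u where "u = (\<lambda>j. w ^ j * cnj w ^ m)"
  have u_cis: "u j = cis ((real j - real m) / real m)" for j
    by (simp add: u_def w_def Complex.DeMoivre cis_cnj cis_mult diff_divide_distrib)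
  have rot: "of_real (R (w ^ k * z)) = cnj z ^ m * (\<Sum>j<n. of_real (a j) * u j ^ k * z ^ j)"
    if "norm z = 1" for z k
  proof -
    have "of_real (R (w ^ k * z)) = cnj (w ^ k * z) ^ m * p (w ^ k * z)"
      by (rule R) (simp add: that w norm_mult norm_power)
    also have "\<dots> = (\<Sum>j<n. cnj z ^ m * (of_real (a j) * (w ^ j * cnj w ^ m) ^ k * z ^ j))"
      by (simp add: p_def n_def sum_distrib_left power_mult_distrib mult_ac
          flip: power_mult del: sum.lessThan_Suc)
    finally show ?thesis by (simp add: u_def sum_distrib_left)
  qed
  \<comment> \<open>Since \<open>2 * (b - a) * (b - c) = (b - a)\<^sup>2 + (c - b)\<^sup>2 - (c -
    a)\<^sup>2\<close>, the integral of \<open>F\<close> is \<open>d h - d (2 * h) / 2\<close> at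
    \<open>h = 1 / m\<close>, with \<open>d\<close> the squared distance between \<open>R\<close>
    and its rotation.\<close>
  define F where "F = (\<lambda>z. (R (w * z) - R z) * (R (w * z) - R (w * w * z)))"
  define E where "E = (\<lambda>z. (\<bar>R z\<bar> - 1)\<^sup>2)"
  have cont_rot: "continuous_on (sphere 0 1) (\<lambda>z. R (v * z))" if "norm v = 1" for v
    using that by (intro continuous_on_compose2[OF cont] continuous_intros) (auto simp: norm_mult)
  have int_E: "integrable circle_measure E"
    unfolding E_def by (intro integrable_circle_continuous continuous_intros cont)
  have int_F: "integrable circle_measure F"
    unfolding F_def by (intro integrable_circle_continuous continuous_intros cont cont_rot w ww)
  have a2: "complex_of_real (a j) * complex_of_real (a j) = 1 / of_nat n" if "j < n" for j
  proof -
    have "complex_of_real (a j) * complex_of_real (a j) = of_real ((a j)\<^sup>2)"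
      by (simp add: power2_eq_square)
    also have "\<dots> = 1 / of_nat n"
      using sq[of j] that by (simp add: n_def)
    finally show ?thesis .
  qed
  have "complex_of_real (\<integral>z. F z \<partial>circle_measure) = (\<integral>z. of_real (F z) \<partial>circle_measure)"
    by simp
  also have "\<dots> = (\<integral>z. (\<Sum>j<n. (of_real (a j) * (u j - 1)) * z ^ j) *
      cnj (\<Sum>j<n. (of_real (a j) * (u j - u j ^ 2)) * z ^ j) \<partial>circle_measure)"
  proof (rule Bochner_Integration.integral_cong)
    fix z :: complex assume "z \<in> space circle_measure"
    then have z: "norm z = 1" by simp
    let ?A = "\<Sum>j<n. (of_real (a j) * (u j - 1)) * z ^ j"
    let ?B = "\<Sum>j<n. (of_real (a j) * (u j - u j ^ 2)) * z ^ j"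
    have A: "of_real (R (w * z) - R z) = cnj z ^ m * ?A"
      using rot[OF z, of 0] rot[OF z, of 1]
      by (simp add: algebra_simps sum_subtractf)
    have B: "of_real (R (w * z) - R (w * w * z)) = cnj z ^ m * ?B"
      using rot[OF z, of 1] rot[OF z, of 2]
      by (simp add: algebra_simps sum_subtractf power2_eq_square)
    \<comment> \<open>Conjugating the second factor is harmless because it is real; it yields the
      Hermitian product of Parseval and cancels \<open>cnj z ^ m\<close>.\<close>
    have "complex_of_real (F z) = of_real (R (w * z) - R z) * cnj (of_real (R (w * z) - R (w * w * z)))"
      by (simp add: F_def)
    also have "\<dots> = (z * cnj z) ^ m * (?A * cnj ?B)"
      unfolding A B by (simp add: power_mult_distrib)
    finally show "of_real (F z) = ?A * cnj ?B"
      using z by (simp flip: complex_norm_square)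
  qed simp
  also have "\<dots> = (\<Sum>j<n. (of_real (a j) * (u j - 1)) * cnj (of_real (a j) * (u j - u j ^ 2)))"
    by (rule integral_circle_parseval)
  also have "\<dots> = (\<Sum>j<n. (u j - 1) * cnj (u j - u j ^ 2)) / of_nat n"
    unfolding sum_divide_distrib
  proof (intro sum.cong refl)
    fix j assume "j \<in> {..<n}"
    have "(of_real (a j) * (u j - 1)) * cnj (of_real (a j) * (u j - u j ^ 2))
        = (complex_of_real (a j) * complex_of_real (a j)) * ((u j - 1) * cnj (u j - u j ^ 2))"
      by simp
    also have "\<dots> = (u j - 1) * cnj (u j - u j ^ 2) / of_nat n"
      using \<open>j \<in> {..<n}\<close> by (subst a2) auto
    finally show "(of_real (a j) * (u j - 1)) * cnj (of_real (a j) * (u j - u j ^ 2))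
        = (u j - 1) * cnj (u j - u j ^ 2) / of_nat n" .
  qed
  finally have "(\<integral>z. F z \<partial>circle_measure) = Re ((\<Sum>j<n. (u j - 1) * cnj (u j - u j ^ 2)) / of_nat n)"
    by (metis Re_complex_of_real)
  also have "\<dots> = (\<Sum>j<n. Re ((u j - 1) * cnj (u j - u j ^ 2))) / real n"
    by simp
  also have "(\<Sum>j<n. Re ((u j - 1) * cnj (u j - u j ^ 2))) =
     (\<Sum>j<n. 1 - 2 * cos ((real j - real m) / real m) + cos (2 * ((real j - real m) / real m)))"
  proof (intro sum.cong refl)
    fix j
    define x where "x = (real j - real m) / real m"
    have "(u j - 1) * cnj (u j - u j ^ 2) = cis x * cis (- x) - cis x * cis (- 2 * x) - cis (- x) + cis (- 2 * x)"
      unfolding u_cis x_def[symmetric] by (simp add: cis_cnj Complex.DeMoivre algebra_simps)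
    then show "Re ((u j - 1) * cnj (u j - u j ^ 2)) = 1 - 2 * cos x + cos (2 * x)"
      by (simp add: cis_mult)
  qed
  also have "\<dots> / real n \<le> - (real n / 24) / real n"
    unfolding n_def by (intro divide_right_mono sum_cos_second_difference_le m) simp
  also have "\<dots> = - (1 / 24)"
    by (simp add: n_def field_simps)
  finally have F_le: "(\<integral>z. F z \<partial>circle_measure) \<le> - (1 / 24)" .
  have E_rot: "(\<integral>z. E (v * z) \<partial>circle_measure) = (\<integral>z. E z \<partial>circle_measure)"
    "integrable circle_measure (\<lambda>z. E (v * z))" if "norm v = 1" for v
    using integral_circle_rotation[OF that, of E] integrable_circle_rotation[OF that int_E] int_E
    by auto
  have "- 1 / 48 - 400 * ((\<integral>z. E z \<partial>circle_measure) + (\<integral>z. E (w * z) \<partial>circle_measure)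
        + (\<integral>z. E (w * w * z) \<partial>circle_measure))
      = (\<integral>z. - 1 / 48 - 400 * (E z + E (w * z) + E (w * w * z)) \<partial>circle_measure)"
    using int_E E_rot(2)[OF w] E_rot(2)[OF ww]
    by (simp add: circle.prob_space del: space_circle_measure)
  also have "\<dots> \<le> (\<integral>z. F z \<partial>circle_measure)"
    using int_E E_rot(2)[OF w] E_rot(2)[OF ww] int_F near_sign_product_ge
    by (intro integral_mono) (auto simp: E_def F_def)
  \<comment> \<open>Rotation invariance makes the three integrals of \<open>E\<close> equal, so the
    bound is \<open>(1 / 24 - 1 / 48) / 1200\<close>.\<close>
  finally have E_ge: "1 / 57600 \<le> (\<integral>z. E z \<partial>circle_measure)"
    using F_le E_rot(1)[OF w] E_rot(1)[OF ww] by simp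
  have int_p: "integrable circle_measure (\<lambda>z. cmod (p z))"
    by (intro integrable_circle_continuous continuous_intros cont_p)
  have int_p2: "integrable circle_measure (\<lambda>z. (cmod (p z))\<^sup>2)"
    by (intro integrable_circle_continuous continuous_intros cont_p)
  have "complex_of_real (\<integral>z. (cmod (p z))\<^sup>2 \<partial>circle_measure) = (\<integral>z. p z * cnj (p z) \<partial>circle_measure)"
    by (simp only: complex_norm_square flip: integral_complex_of_real)
  also have "\<dots> = (\<Sum>j<n. of_real (a j) * cnj (of_real (a j)))"
    unfolding p_def n_def by (rule integral_circle_parseval)
  also have "\<dots> = (\<Sum>j<n. 1 / of_nat n)"
    using a2 by (intro sum.cong) auto
  also have "\<dots> = 1" using \<open>n \<noteq> 0\<close> by simp
  finally have p2: "(\<integral>z. (cmod (p z))\<^sup>2 \<partial>circle_measure) = 1"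
    using of_real_eq_1_iff by blast
  have "(\<integral>z. E z \<partial>circle_measure) = (\<integral>z. (cmod (p z))\<^sup>2 - 2 * cmod (p z) + 1 \<partial>circle_measure)"
  proof (rule Bochner_Integration.integral_cong)
    fix z :: complex assume "z \<in> space circle_measure"
    then have "\<bar>R z\<bar> = cmod (p z)" by (intro absR) simp
    then show "E z = (cmod (p z))\<^sup>2 - 2 * cmod (p z) + 1"
      by (simp only: E_def power2_diff) simp
  qed simp
  also have "\<dots> = 2 - 2 * (\<integral>z. cmod (p z) \<partial>circle_measure)"
    using int_p int_p2 by (simp add: p2 circle.prob_space del: space_circle_measure)
  \<comment> \<open>Halving \<open>1 / 57600\<close> gives a gap of \<open>1 / 115200\<close>, which
    is rounded down to \<open>1 / 120000\<close>.\<close>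
  finally show ?thesis using E_ge by simp
qed

section \<open>Logarithms of polynomials on the circle\<close>

lemma emeasure_circle_singleton:
  assumes "norm a = 1"
  shows "emeasure circle_measure {a} = 0"
proof -
  have "{a} \<in> sets circle_measure"
    using assms by (simp add: sets_circle_measure sets_restrict_space_iff)
  then have "emeasure circle_measure {a} =
      emeasure lborel ({0..<2 * pi} \<inter> cis -` {a}) / ennreal (2 * pi)"
    by (rule emeasure_circle)
  also have "{0..<2 * pi} \<inter> cis -` {a} \<subseteq> {Arg2pi a}"
    by (auto simp: cis_conv_exp intro!: Arg2pi_unique[symmetric, of 1])
  then have "finite ({0..<2 * pi} \<inter> cis -` {a})"
    by (rule finite_subset) simp
  then have "emeasure lborel ({0..<2 * pi} \<inter> cis -` {a}) = 0"
    by (intro emeasure_lborel_countable countable_finite)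
  finally show ?thesis by simp
qed

text \<open>The finitely many roots form a null set. Off it, \<open>ln\<close> is additive on
  products and \<open>ln x \<le> x - 1\<close> holds; the default \<open>ln 0 = 0\<close> would
  break both.\<close>

lemma AE_circle_poly_nonzero:
  fixes p :: "complex poly"
  assumes "p \<noteq> 0"
  shows "AE z in circle_measure. poly p z \<noteq> 0"
proof -
  have "AE z in circle_measure. z \<noteq> a" if "norm a = 1" for a
    using emeasure_circle_singleton[OF that] that
    by (intro AE_I[of _ _ "{a}"]) (auto simp: sets_circle_measure sets_restrict_space_iff)
  then have "AE z in circle_measure. \<forall>a\<in>{a. poly p a = 0 \<and> norm a = 1}. z \<noteq> a"
    using poly_roots_finite[OF assms] by (subst AE_finite_all) auto
  then show ?thesis
    by (rule AE_mp) (rule AE_I2, auto)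
qed

lemma measurable_ln_poly_circle:
  fixes p :: "complex poly"
  shows "(\<lambda>z. ln (cmod (poly p z))) \<in> borel_measurable circle_measure"
proof -
  have "(\<lambda>z. cmod (poly p z)) \<in> borel_measurable circle_measure"
    by (intro borel_measurable_circle_continuous continuous_intros)
  then show ?thesis by measurable
qed

section \<open>Integrability of the logarithm of a linear factor\<close>

lemma sin_ge_quarter:
  fixes x :: real
  assumes "0 \<le> x" "x \<le> pi / 2"
  shows "x / 4 \<le> sin x"
proof (cases "x \<le> 1")
  case True
  then show ?thesis using sin_ge_half[of x] assms by simp
next
  case False
  \<comment> \<open>Beyond 1 monotonicity suffices: \<open>sin x \<ge> 1 / 2\<close>, and
    \<open>x / 4 < 1 / 2\<close> because \<open>pi < 4\<close>.\<close>
  then have "sin 1 \<le> sin x"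
    using assms by (intro sin_monotone_2pi_le) auto
  moreover have "1 / 2 \<le> sin (1 :: real)" using sin_ge_half[of 1] by simp
  ultimately show ?thesis using assms pi_less_4 by simp
qed

text \<open>In HOL \<open>sqrt\<close> is an odd function on the reals, so
  \<open>2 * sqrt (t - c)\<close> is a continuous antiderivative on both sides of the singularity
  \<open>c\<close>. Nonnegativity upgrades integrability to absolute integrability.\<close>

lemma set_integrable_inverse_sqrt:
  fixes c :: real
  assumes "a \<le> c" "c \<le> b"
  shows "set_integrable lborel {a..b} (\<lambda>t. inverse (sqrt \<bar>t - c\<bar>))"
proof -
  have "((\<lambda>t. inverse (sqrt \<bar>t - c\<bar>)) has_integral (2 * sqrt (b - c) - 2 * sqrt (a - c))) {a..b}"
  proof (rule fundamental_theorem_of_calculus_interior_strong[where S = "{c}"])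
    fix t assume "t \<in> {a<..<b} - {c}"
    then consider "t < c" | "c < t" by force
    then have "(sqrt has_real_derivative inverse (sqrt \<bar>t - c\<bar>) / 2) (at (t - c))"
    proof cases
      case 1
      then have "sqrt \<bar>t - c\<bar> = - sqrt (t - c)"
        by (simp flip: real_sqrt_minus)
      with 1 show ?thesis by (intro DERIV_real_sqrt_generic) auto
    next
      case 2
      then show ?thesis by (intro DERIV_real_sqrt_generic) auto
    qed
    then have "((\<lambda>t. 2 * sqrt (t - c)) has_real_derivative 2 * (inverse (sqrt \<bar>t - c\<bar>) / 2 * 1)) (at t)"
      by (intro DERIV_cmult DERIV_chain2[where f = sqrt]) (auto intro!: derivative_eq_intros)
    then show "((\<lambda>t. 2 * sqrt (t - c)) has_vector_derivative inverse (sqrt \<bar>t - c\<bar>)) (at t)"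
      by (simp add: has_real_derivative_iff_has_vector_derivative)
  next
    show "continuous_on {a..b} (\<lambda>t. 2 * sqrt (t - c))"
      by (intro continuous_intros)
  qed (use assms in auto)
  then have "(\<lambda>t. inverse (sqrt \<bar>t - c\<bar>)) absolutely_integrable_on {a..b}"
    by (intro nonnegative_absolutely_integrable_1) (auto simp: integrable_on_def)
  then show ?thesis
    unfolding set_integrable_def by (subst (asm) integrable_completion) auto
qed

text \<open>Applying \<open>ln_le_minus_one\<close> to \<open>x\<close> bounds \<open>ln x\<close>
  above; applying it to \<open>inverse (sqrt y)\<close> bounds it below with an integrable
  singularity.\<close>

lemma abs_ln_le_inverse_sqrt:
  fixes x y :: real
  assumes "0 < y" "y \<le> x" "x \<le> 2"
  shows "\<bar>ln x\<bar> \<le> 2 + 2 * inverse (sqrt y)"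
proof -
  have "ln x \<le> x - 1" using assms by (intro ln_le_minus_one) auto
  moreover have "- ln x \<le> - ln y" using assms by simp
  moreover have "- ln y = 2 * ln (inverse (sqrt y))"
    using assms by (simp add: ln_inverse ln_sqrt)
  moreover have "ln (inverse (sqrt y)) \<le> inverse (sqrt y) - 1"
    using assms by (intro ln_le_minus_one) auto
  moreover have "0 \<le> inverse (sqrt y)" using assms by simp
  ultimately show ?thesis using assms by linarith
qed

lemma cmod_cis_add_one: "cmod (cis t + 1) = 2 * \<bar>cos (t / 2)\<bar>"
proof -
  have "(cmod (cis t + 1))\<^sup>2 = 2 + 2 * cos t"
    by (simp add: cmod_power2 sin_squared_eq power2_sum)
  also have "\<dots> = (2 * \<bar>cos (t / 2)\<bar>)\<^sup>2"
    using cos_double_cos[of "t / 2"] by (simp add: power_mult_distrib)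
  finally show ?thesis by (rule power2_eq_imp_eq) auto
qed

text \<open>The zero \<open>- 1\<close> has angle \<open>pi\<close>, inside the interval of angles,
  so there is a single singularity to dominate. There \<open>cmod (cis t + 1)\<close> is at least
  \<open>\<bar>t - pi\<bar> / 4\<close>.\<close>

lemma integrable_circle_ln_add_one:
  "integrable circle_measure (\<lambda>z. ln (cmod (z + 1)))"
proof -
  let ?U = "uniform_measure lborel {0..<2 * pi}"
  interpret U: prob_space ?U
    by (rule prob_space_uniform_measure) auto
  have dens: "?U = density lborel (\<lambda>t. ennreal (indicator {0..<2 * pi} t / (2 * pi)))"
    unfolding uniform_measure_def
    by (intro density_cong AE_I2) (auto simp: indicator_def divide_ennreal simp flip: ennreal_1)
  have "integrable lborel (\<lambda>t. indicator {0..2*pi} t *\<^sub>R inverse (sqrt \<bar>t - pi\<bar>))"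
    using set_integrable_inverse_sqrt[of 0 pi "2 * pi"] by (simp add: set_integrable_def)
  then have "integrable lborel (\<lambda>t. (1 / (2 * pi)) *\<^sub>R (indicator {0..2*pi} t *\<^sub>R inverse (sqrt \<bar>t - pi\<bar>)))"
    by (rule integrable_scaleR_right)
  then have "integrable lborel (\<lambda>t. (indicator {0..<2 * pi} t / (2 * pi)) *\<^sub>R inverse (sqrt \<bar>t - pi\<bar>))"
    by (rule Bochner_Integration.integrable_bound) (auto simp: indicator_def)
  then have "integrable ?U (\<lambda>t. inverse (sqrt \<bar>t - pi\<bar>))"
    unfolding dens by (subst integrable_density) auto
  then have dom: "integrable ?U (\<lambda>t. 2 + 2 * (2 * inverse (sqrt \<bar>t - pi\<bar>)))"
    by auto
  have "integrable ?U (\<lambda>t. ln (cmod (cis t + 1)))"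
  proof (rule Bochner_Integration.integrable_bound[OF dom])
    have "AE t in ?U. t \<in> {0..<2 * pi}"
      by (rule AE_uniform_measureI) auto
    then show "AE t in ?U. norm (ln (cmod (cis t + 1))) \<le> norm (2 + 2 * (2 * inverse (sqrt \<bar>t - pi\<bar>)))"
    proof (rule AE_mp, intro AE_I2 impI)
      fix t assume t: "t \<in> {0..<2 * pi}"
      show "norm (ln (cmod (cis t + 1))) \<le> norm (2 + 2 * (2 * inverse (sqrt \<bar>t - pi\<bar>)))"
      proof (cases "t = pi")
        case False
        have "cos (t / 2) = sin ((pi - t) / 2)"
          by (simp add: cos_sin_eq diff_divide_distrib)
        moreover have "sin ((t - pi) / 2) = - sin ((pi - t) / 2)"
          unfolding sin_minus[symmetric] by (rule arg_cong[where f = sin]) (simp add: field_simps)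
        ultimately have "sin (\<bar>t - pi\<bar> / 2) \<le> \<bar>cos (t / 2)\<bar>"
          by (auto simp: abs_if)
        moreover have "\<bar>t - pi\<bar> / 2 / 4 \<le> sin (\<bar>t - pi\<bar> / 2)"
          using t by (intro sin_ge_quarter) (auto simp: abs_if)
        ultimately have "\<bar>t - pi\<bar> / 4 \<le> cmod (cis t + 1)"
          by (simp add: cmod_cis_add_one)
        then have "\<bar>ln (cmod (cis t + 1))\<bar> \<le> 2 + 2 * inverse (sqrt (\<bar>t - pi\<bar> / 4))"
          using False norm_triangle_ineq[of "cis t" 1] by (intro abs_ln_le_inverse_sqrt) auto
        then show ?thesis by (simp add: real_sqrt_divide inverse_eq_divide)
      \<comment> \<open>At \<open>t = pi\<close> the logarithm is \<open>ln 0 = 0\<close>, so the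
        bound is immediate.\<close>
      qed simp
    qed
  next
    have [measurable]: "cis \<in> borel_measurable borel"
      by (intro borel_measurable_continuous_onI continuous_intros)
    show "(\<lambda>t. ln (cmod (cis t + 1))) \<in> borel_measurable ?U"
      by measurable
  qed
  moreover have "(\<lambda>z :: complex. ln (cmod (z + 1))) \<in> borel_measurable (restrict_space borel (sphere 0 1))"
    by (rule measurable_restrict_space1) measurable
  moreover have "cis \<in> ?U \<rightarrow>\<^sub>M restrict_space borel (sphere 0 1)"
    by measurable
  ultimately show ?thesis
    unfolding circle_measure_def by (simp add: integrable_distr_eq)
qed

text \<open>The rotation by \<open>- cnj a\<close> carries \<open>a\<close> to \<open>- 1\<close>
  and reduces the claim to the previous case.\<close>

lemma integrable_circle_ln_diff:
  assumes "norm a = 1"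
  shows "integrable circle_measure (\<lambda>z. ln (cmod (z - a)))"
proof -
  have "integrable circle_measure (\<lambda>z. ln (cmod (- cnj a * z + 1)))"
    using assms by (intro integrable_circle_rotation integrable_circle_ln_add_one) auto
  moreover have "cmod (- cnj a * z + 1) = cmod (z - a)" for z
  proof -
    have "cmod (z - a) = cmod (- cnj a * (z - a))"
      using assms by (simp add: norm_mult)
    also have "- cnj a * (z - a) = - cnj a * z + 1"
      using assms by (simp add: algebra_simps flip: complex_norm_square)
    finally show ?thesis ..
  qed
  ultimately show ?thesis by simp
qed

text \<open>If the logarithm were not integrable, its Bochner integral would be \<open>0\<close> and
  \<open>mahler_measure p\<close> would be \<open>1\<close> by convention.\<close>

lemma integrable_circle_ln_poly:
  fixes p :: "complex poly"
  assumes "p \<noteq> 0"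
  shows "integrable circle_measure (\<lambda>z. ln (cmod (poly p z)))"
  using assms
proof (induction "degree p" arbitrary: p rule: less_induct)
  case less
  show ?case
  \<comment> \<open>Without zeros on the circle the logarithm is continuous; otherwise a linear
    factor is split off and the degree drops.\<close>
  proof (cases "\<exists>a. norm a = 1 \<and> poly p a = 0")
    case False
    then show ?thesis
      by (intro integrable_circle_continuous continuous_intros) auto
  next
    case True
    then obtain a r where a: "norm a = 1" and p: "p = [:- a, 1:] * r"
      by (auto simp: poly_eq_0_iff_dvd dvd_def)
    from less.prems p have r: "r \<noteq> 0" by auto
    then have "degree p = Suc (degree r)"
      unfolding p by (subst degree_mult_eq) auto
    then have "integrable circle_measure (\<lambda>z. ln (cmod (poly r z)))"
      using r by (intro less.hyps) auto
    with integrable_circle_ln_diff[OF a]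
    have "integrable circle_measure (\<lambda>z. ln (cmod (z - a)) + ln (cmod (poly r z)))"
      by (rule Bochner_Integration.integrable_add)
    moreover have "AE z in circle_measure.
        ln (cmod (z - a)) + ln (cmod (poly r z)) = ln (cmod (poly p z))"
      using AE_circle_poly_nonzero[OF less.prems]
    proof (rule AE_mp, intro AE_I2 impI)
      fix z assume "poly p z \<noteq> 0"
      moreover have "poly p z = (z - a) * poly r z"
        by (simp add: p algebra_simps)
      ultimately show "ln (cmod (z - a)) + ln (cmod (poly r z)) = ln (cmod (poly p z))"
        by (simp add: norm_mult ln_mult)
    qed
    ultimately show ?thesis
      using integrable_cong_AE_imp measurable_ln_poly_circle by blast
  qed
qed

text \<open>Integrating \<open>ln x \<le> x - 1\<close> gives a bound weaker than Jensen's
  inequality, but it still forces the Mahler measure below 1 when the L1 norm is.\<close>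

lemma mahler_measure_le:
  "mahler_measure p \<le> exp ((\<integral>z. cmod (poly p z) \<partial>circle_measure) - 1)"
proof (cases "p = 0")
  case False
  have int: "integrable circle_measure (\<lambda>z. cmod (poly p z))"
    by (intro integrable_circle_continuous continuous_intros)
  have "(\<integral>z. ln (cmod (poly p z)) \<partial>circle_measure) \<le> (\<integral>z. cmod (poly p z) - 1 \<partial>circle_measure)"
  proof (rule integral_mono_AE)
    show "AE z in circle_measure. ln (cmod (poly p z)) \<le> cmod (poly p z) - 1"
      using AE_circle_poly_nonzero[OF False]
      by (rule AE_mp) (rule AE_I2, auto intro: ln_le_minus_one)
  qed (use int integrable_circle_ln_poly[OF False] in auto)
  also have "\<dots> = (\<integral>z. cmod (poly p z) \<partial>circle_measure) - 1"
    using int by (simp add: circle.prob_space del: space_circle_measure)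
  finally show ?thesis using False by (simp add: mahler_measure_def)
qed (simp add: mahler_measure_def)

section \<open>Flatness\<close>

text \<open>A Markov-type argument, valid for every positive exponent: where the modulus deviates
  from 1 by more than \<eta>, the subtracted term is at least 1 and the pointwise lower bound is
  negative.\<close>

lemma L1_norm_ge_powr_deviation:
  assumes "0 < \<alpha>" "0 < \<eta>"
  shows "1 - \<eta> - \<eta> powr - \<alpha> * (\<integral>z. \<bar>cmod (poly p z) - 1\<bar> powr \<alpha> \<partial>circle_measure)
    \<le> (\<integral>z. cmod (poly p z) \<partial>circle_measure)"
proof -
  have int1: "integrable circle_measure (\<lambda>z. cmod (poly p z))"
    by (intro integrable_circle_continuous continuous_intros)
  have int2: "integrable circle_measure (\<lambda>z. \<bar>cmod (poly p z) - 1\<bar> powr \<alpha>)"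
    using assms by (intro integrable_circle_continuous continuous_on_powr' continuous_intros) auto
  have pt: "1 - \<eta> - \<eta> powr - \<alpha> * \<bar>x - 1\<bar> powr \<alpha> \<le> x" if "0 \<le> x" for x :: real
  proof (cases "\<bar>x - 1\<bar> \<le> \<eta>")
    case True
    have "0 \<le> \<eta> powr - \<alpha> * \<bar>x - 1\<bar> powr \<alpha>" by simp
    with True show ?thesis by linarith
  next
    case False
    then have "\<eta> powr \<alpha> \<le> \<bar>x - 1\<bar> powr \<alpha>"
      using assms by (intro powr_mono2) auto
    then have "\<eta> powr - \<alpha> * \<eta> powr \<alpha> \<le> \<eta> powr - \<alpha> * \<bar>x - 1\<bar> powr \<alpha>"
      by (intro mult_left_mono) auto
    moreover have "\<eta> powr - \<alpha> * \<eta> powr \<alpha> = 1"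
      using assms by (simp flip: powr_add)
    ultimately show ?thesis using assms that by simp
  qed
  have "1 - \<eta> - \<eta> powr - \<alpha> * (\<integral>z. \<bar>cmod (poly p z) - 1\<bar> powr \<alpha> \<partial>circle_measure)
      = (\<integral>z. 1 - \<eta> - \<eta> powr - \<alpha> * \<bar>cmod (poly p z) - 1\<bar> powr \<alpha> \<partial>circle_measure)"
    using int2 by (simp add: circle.prob_space del: space_circle_measure)
  also have "\<dots> \<le> (\<integral>z. cmod (poly p z) \<partial>circle_measure)"
    by (rule integral_mono) (use int1 int2 pt in simp_all)
  finally show ?thesis .
qed

text \<open>The leading coefficient is nonzero, so even degree means \<open>q = 2 * m + 1\<close>.
  The case \<open>q = 1\<close> has to be excluded: there the modulus is constantly 1.\<close>

lemma littlewood_L1_norm_gap: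
  assumes q: "1 < q" and lw: "normalized_littlewood q p"
    and pal: "palindromic p" and ev: "even (degree p)"
  shows "(\<integral>z. cmod (poly p z) \<partial>circle_measure) \<le> 1 - 1 / 120000"
proof -
  obtain \<epsilon> :: "nat \<Rightarrow> real" where \<epsilon>: "\<forall>j<q. \<epsilon> j \<in> {1, -1}"
    and p: "p = smult (complex_of_real (1 / sqrt (real q))) (\<Sum>j<q. monom (complex_of_real (\<epsilon> j)) j)"
    using lw unfolding normalized_littlewood_def by (elim exE conjE)
  define a where "a = (\<lambda>j. \<epsilon> j / sqrt (real q))"
  have coeff: "coeff p j = (if j < q then of_real (a j) else 0)" for j
    by (simp add: p a_def coeff_sum)
  have nz: "a j \<noteq> 0" if "j < q" for j
    using \<epsilon> that by (auto simp: a_def)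
  have deg: "degree p = q - 1"
  proof (rule antisym)
    show "degree p \<le> q - 1"
      by (rule degree_le) (use q in \<open>auto simp: coeff\<close>)
    show "q - 1 \<le> degree p"
      by (rule le_degree) (use q nz[of "q - 1"] in \<open>simp add: coeff\<close>)
  qed
  obtain m where m: "degree p = 2 * m" using ev by (elim evenE)
  have qm: "q = 2 * m + 1" using deg m q by linarith
  have "poly p z = (\<Sum>j<2 * m + 1. of_real (a j) * z ^ j)" for z
    unfolding poly_altdef m by (intro sum.cong) (auto simp: coeff qm)
  moreover have "(\<integral>z. cmod (\<Sum>j<2 * m + 1. of_real (a j) * z ^ j) \<partial>circle_measure) \<le> 1 - 1 / 120000"
  proof (rule palindromic_L1_norm_gap)
    show "0 < m" using qm q by simp
    fix j assume j: "j \<le> 2 * m"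
    then have "j < q" using qm by simp
    then have "\<epsilon> j = 1 \<or> \<epsilon> j = - 1" using \<epsilon> by blast
    then show "(a j)\<^sup>2 = 1 / real (2 * m + 1)"
      by (auto simp: a_def power_divide qm)
    have "coeff p j = coeff p (2 * m - j)"
      using pal j unfolding palindromic_def m by blast
    moreover have "2 * m - j < Suc (2 * m)" by simp
    ultimately show "a (2 * m - j) = a j" using j by (simp add: coeff qm)
  qed
  ultimately show ?thesis by (simp only:)
qed

theorem theorem2p3:
  fixes Q :: "nat set" and P :: "nat \<Rightarrow> complex poly" and \<alpha> :: real
  assumes "infinite Q" and "\<forall>q\<in>Q. 0 < q"
    and "\<forall>q\<in>Q. normalized_littlewood q (P q)"
    and "\<forall>q\<in>Q. palindromic (P q) \<and> even (degree (P q))"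
    and "\<alpha> \<ge> 0"
  shows "\<not> flat \<alpha> Q P"
proof
  assume flat: "flat \<alpha> Q P"
  define F where "F = inf sequentially (principal Q)"
  define \<delta> :: real where "\<delta> = 1 / 120000"
  \<comment> \<open>Infinitude of \<open>Q\<close> makes \<open>F\<close> a proper filter, so an
    eventually false statement is a contradiction.\<close>
  have "F \<noteq> bot"
    using assms(1) unfolding F_def trivial_limit_def eventually_inf_principal
    by (auto simp: eventually_sequentially infinite_nat_iff_unbounded_le)
  have gap: "\<forall>\<^sub>F q in F. (\<integral>z. cmod (poly (P q) z) \<partial>circle_measure) \<le> 1 - \<delta>"
    unfolding F_def eventually_inf_principal
    using eventually_gt_at_top[of 1]
    by eventually_elim (use assms littlewood_L1_norm_gap in \<open>auto simp: \<delta>_def\<close>)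
  show False
  proof (cases "\<alpha> = 0")
    case True
    then have "((\<lambda>q. mahler_measure (P q)) \<longlongrightarrow> 1) F"
      using flat by (simp add: flat_def F_def)
    moreover have "exp (- \<delta>) < 1" by (simp add: \<delta>_def)
    ultimately have "\<forall>\<^sub>F q in F. exp (- \<delta>) < mahler_measure (P q)"
      by (rule order_tendstoD)
    with gap have "\<forall>\<^sub>F q in F. False"
    proof eventually_elim
      case (elim q)
      have "mahler_measure (P q) \<le> exp (- \<delta>)"
        by (rule order_trans[OF mahler_measure_le]) (use elim(1) in simp)
      with elim(2) show False by simp
    qed
    with \<open>F \<noteq> bot\<close> show False by (simp add: trivial_limit_def)
  next
    case False
    with assms have \<alpha>: "0 < \<alpha>" by simp
    define J where "J = (\<lambda>q. \<integral>z. \<bar>cmod (poly (P q) z) - 1\<bar> powr \<alpha> \<partial>circle_measure)"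
    have "(J \<longlongrightarrow> 0) F"
      using flat False by (simp add: flat_def F_def J_def)
    \<comment> \<open>With \<eta> equal to \<open>\<delta> / 2\<close>, both losses together are
      eventually below \<delta>, which contradicts \<open>gap\<close>.\<close>
    then have "((\<lambda>q. (\<delta> / 2) powr - \<alpha> * J q) \<longlongrightarrow> 0) F"
      by (rule tendsto_mult_right_zero)
    then have "\<forall>\<^sub>F q in F. (\<delta> / 2) powr - \<alpha> * J q < \<delta> / 2"
      by (rule order_tendstoD) (simp add: \<delta>_def)
    with gap have "\<forall>\<^sub>F q in F. False"
    proof eventually_elim
      case (elim q)
      have "1 - \<delta> / 2 - (\<delta> / 2) powr - \<alpha> * J q \<le> (\<integral>z. cmod (poly (P q) z) \<partial>circle_measure)"
        unfolding J_def by (rule L1_norm_ge_powr_deviation) (use \<alpha> in \<open>auto simp: \<delta>_def\<close>)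
      with elim show False by simp
    qed
    with \<open>F \<noteq> bot\<close> show False by (simp add: trivial_limit_def)
  qed
qed

end
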